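(* For any fixed $\epsilon > 0$, there is a deterministic two-pass streaming algorithm that, for every general (not necessarily bipartite) graph $G$ on $n$ vertices whose edges arrive in a stream in arbitrary order, finds the edges of a $(2-\sqrt{2}-\epsilon)$-approximate maximum matching of $G$, i.e. outputs a matching of $G$ of size at least $(2-\sqrt{2}-\epsilon)\cdot\mu(G)$, using $O(n)$ space.
   Context: $\mu(G)$ denotes the size of a maximum matching of $G$. Streaming model: the edges of the input graph $G$ appear one by one in an arbitrary order; a two-pass algorithm makes two passes over the stream and must then output the edges of a matching of $G$, while keeping only limited memory at any time. Space is measured in the number of stored edges (words); since $\epsilon$ is fixed, the constant hidden in $O(n)$ may depend on $\epsilon$. *)

theory Defs
  imports Complex_Main "HOL-Library.Landau_Symbols"
begin

text \<open>
  A graph on \<open>n\<close> vertices has vertex set \<open>{..<n}\<close> and is given by its edge set; it is finite,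
  undirected and simple, but otherwise arbitrary.
\<close>

type_synonym edge = "nat set"

definition graph_on :: "nat \<Rightarrow> edge set \<Rightarrow> bool" where
  "graph_on n E \<longleftrightarrow> (\<forall>e\<in>E. e \<subseteq> {..<n} \<and> card e = 2)"

definition matching :: "edge set \<Rightarrow> edge set \<Rightarrow> bool" where
  "matching E M \<longleftrightarrow> M \<subseteq> E \<and> pairwise disjnt M"

definition matching_number :: "edge set \<Rightarrow> nat" where
  "matching_number E = Max (card ` {M. matching E M})"

definition edge_stream :: "edge set \<Rightarrow> edge list \<Rightarrow> bool" where
  "edge_stream E xs \<longleftrightarrow> set xs = E \<and> distinct xs"

text \<open>
  The memory is a sequence of words. For inputs on \<open>n\<close> vertices a word holds a number in \<open>{0..n}\<close>,
  that is \<open>O(log n)\<close> bits; so a stored edge costs two words, and space in words and space in stored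
  edges agree up to constant factors.

  The algorithm knows the number \<open>n\<close> of vertices and the index of the current pass. Everything it
  remembers about the edges seen so far has to be in the memory. As usual for streaming
  space bounds, the internal computation of a single transition is not charged.
\<close>

type_synonym memory = "nat list"

record streaming_algorithm =
  init_mem :: "nat \<Rightarrow> memory"
  process_edge :: "nat \<Rightarrow> nat \<Rightarrow> edge \<Rightarrow> memory \<Rightarrow> memory"
  finish_pass :: "nat \<Rightarrow> nat \<Rightarrow> memory \<Rightarrow> memory"
  output_edges :: "nat \<Rightarrow> memory \<Rightarrow> edge set"

text \<open>
  In the following functions \<open>n\<close> is the number of vertices; passes are numbered from \<open>0\<close>, and all
  of them read the same list \<open>xs\<close>.
\<close>

fun mem_after_passes :: "streaming_algorithm \<Rightarrow> nat \<Rightarrow> edge list \<Rightarrow> nat \<Rightarrow> memory" where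
  "mem_after_passes A n xs 0 = init_mem A n"
| "mem_after_passes A n xs (Suc p) =
     finish_pass A n p (fold (process_edge A n p) xs (mem_after_passes A n xs p))"

definition mem_during_pass ::
    "streaming_algorithm \<Rightarrow> nat \<Rightarrow> edge list \<Rightarrow> nat \<Rightarrow> nat \<Rightarrow> memory" where
  "mem_during_pass A n xs p i =
     fold (process_edge A n p) (take i xs) (mem_after_passes A n xs p)"

definition result :: "streaming_algorithm \<Rightarrow> nat \<Rightarrow> nat \<Rightarrow> edge list \<Rightarrow> edge set" where
  "result A k n xs = output_edges A n (mem_after_passes A n xs k)"

definition memories :: "streaming_algorithm \<Rightarrow> nat \<Rightarrow> nat \<Rightarrow> edge list \<Rightarrow> memory set" where
  "memories A k n xs =
     {mem_during_pass A n xs p i | p i. p < k \<and> i \<le> length xs}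
     \<union> {mem_after_passes A n xs p | p. p \<le> k}"

definition fits_space :: "nat \<Rightarrow> nat \<Rightarrow> memory \<Rightarrow> bool" where
  "fits_space n s m \<longleftrightarrow> length m \<le> s \<and> set m \<subseteq> {0..n}"

definition runs_in_space :: "streaming_algorithm \<Rightarrow> nat \<Rightarrow> (nat \<Rightarrow> nat) \<Rightarrow> bool" where
  "runs_in_space A k s \<longleftrightarrow>
     (\<forall>n E xs. graph_on n E \<longrightarrow> edge_stream E xs \<longrightarrow>
        (\<forall>m\<in>memories A k n xs. fits_space n (s n) m))"

definition approximates_matching :: "streaming_algorithm \<Rightarrow> nat \<Rightarrow> real \<Rightarrow> bool" where
  "approximates_matching A k \<alpha> \<longleftrightarrow>
     (\<forall>n E xs. graph_on n E \<longrightarrow> edge_stream E xs \<longrightarrow>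
        matching E (result A k n xs) \<and>
        real (card (result A k n xs)) \<ge> \<alpha> * real (matching_number E))"

end

theory Submission
  imports Defs
begin

text \<open>
  The first pass computes a greedy maximal matching \<open>M\<close>. The second pass keeps edges with exactly
  one end in \<open>\<Union>M\<close>, at most \<open>a\<close> at each vertex of \<open>\<Union>M\<close> and at most \<open>b\<close> at every other vertex; call
  them \<open>H\<close>. The output is a maximum matching of \<open>M \<union> H\<close>.

  Weight \<open>1 - a / b\<close> on \<open>M\<close> and about \<open>1 / b\<close> on \<open>H\<close> is a fractional matching. An edge of an optimal
  matching with one end in \<open>\<Union>M\<close> was either kept or has a saturated end, which bounds the weight of
  \<open>H\<close> from below; for \<open>a / b\<close> just below \<open>sqrt 2 - 1\<close> the total becomes almost \<open>2 - sqrt 2\<close> times the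
  optimum, whatever the size of \<open>M\<close>. For large \<open>b\<close> this fractional matching nearly satisfies the odd set
  constraints, also in nonbipartite graphs: in small odd sets \<open>H\<close> is negligible, in large ones
  the constraint is. Hence, by the Tutte--Berge formula, it can be made integral at small cost.
\<close>

section \<open>Matchings\<close>

lemma graph_on_finite:
  assumes "graph_on n E"
  shows "finite E"
proof -
  have "E \<subseteq> Pow {..<n}"
    using assms by (auto simp: graph_on_def)
  thus ?thesis
    by (rule finite_subset) simp
qed

lemma edge_other_end:
  assumes "card e = 2" "x \<in> e"
  obtains y where "e = {x, y}" "x \<noteq> y"
  using assms by (auto simp: card_2_iff)

lemma matching_empty [simp]: "matching E {}"
  by (simp add: matching_def)

lemma matching_mono: "matching E M \<Longrightarrow> E \<subseteq> E' \<Longrightarrow> matching E' M"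
  by (auto simp: matching_def)

lemma matching_subset: "matching E M \<Longrightarrow> N \<subseteq> M \<Longrightarrow> matching E N"
  by (auto simp: matching_def intro: pairwise_subset)

lemma matching_finite: "finite E \<Longrightarrow> matching E M \<Longrightarrow> finite M"
  by (auto simp: matching_def intro: finite_subset)

lemma matching_unique:
  assumes "matching E M" "e \<in> M" "f \<in> M" "v \<in> e" "v \<in> f"
  shows "e = f"
  using assms by (auto simp: matching_def pairwise_def disjnt_def)

lemma matching_disjoint:
  "matching E M \<Longrightarrow> e \<in> M \<Longrightarrow> f \<in> M \<Longrightarrow> e \<noteq> f \<Longrightarrow> e \<inter> f = {}"
  by (auto simp: matching_def pairwise_def disjnt_def)

lemma matching_insert:
  assumes "matching E M" "e \<in> E" "e \<inter> \<Union>M = {}"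
  shows "matching E (insert e M)"
proof -
  have "disjnt e f \<and> disjnt f e" if "f \<in> M" for f
    using assms(3) that by (auto simp: disjnt_def)
  thus ?thesis
    using assms(1,2) by (auto simp: matching_def pairwise_insert)
qed

lemma finite_matching_cards:
  assumes "finite E"
  shows "finite (card ` {M. matching E M})"
proof -
  have "{M. matching E M} \<subseteq> Pow E"
    by (auto simp: matching_def)
  thus ?thesis
    using assms by (meson finite_Pow_iff finite_imageI finite_subset)
qed

lemma card_le_matching_number:
  assumes "finite E" "matching E M"
  shows "card M \<le> matching_number E"
  unfolding matching_number_def
  by (rule Max_ge) (use assms finite_matching_cards in auto)

lemma maximum_matching_exists:
  assumes "finite E"
  obtains M where "matching E M" "card M = matching_number E"
proof -
  have "card ` {M. matching E M} \<noteq> {}"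
    using matching_empty[of E] by blast
  hence "matching_number E \<in> card ` {M. matching E M}"
    unfolding matching_number_def using finite_matching_cards[OF assms] by (rule Max_in[rotated])
  thus ?thesis
    using that by auto
qed

lemma matching_card_Union:
  assumes "matching E M" "\<And>e. e \<in> E \<Longrightarrow> card e = 2"
  shows "card (\<Union>M) = 2 * card M"
proof -
  have c: "card e = 2" if "e \<in> M" for e
    using assms that by (auto simp: matching_def)
  have "card (\<Union>M) = sum card M"
    by (rule card_Union_disjoint)
       (use assms(1) c in \<open>auto simp: matching_def card_ge_0_finite\<close>)
  also have "\<dots> = 2 * card M"
    using c by simp
  finally show ?thesis .
qed

text \<open>The edges of \<open>M\<close> inside \<open>C\<close> cover twice their number of
  vertices of \<open>C\<close>. With the rounding down, this is the odd set constraint for a single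
  matching.\<close>

lemma matching_within:
  assumes "matching E M" "\<And>e. e \<in> E \<Longrightarrow> card e = 2" "finite C"
  shows "card {e\<in>M. e \<subseteq> C} \<le> card C div 2"
proof -
  have "2 * card {e\<in>M. e \<subseteq> C} = card (\<Union>{e\<in>M. e \<subseteq> C})"
    using matching_card_Union[OF matching_subset[OF assms(1), of "{e\<in>M. e \<subseteq> C}"] assms(2)]
    by simp
  also have "\<dots> \<le> card C"
    by (rule card_mono) (use assms in auto)
  finally show ?thesis
    by linarith
qed

section \<open>Odd set covers\<close>

definition maximum_matching :: "edge set \<Rightarrow> edge set \<Rightarrow> bool" where
  "maximum_matching E M \<longleftrightarrow> matching E M \<and> card M = matching_number E"

text \<open>
  Gallai's lemma: if every vertex is missed by some maximum matching, then never being missed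
  together is a transitive relation.
\<close>

lemma gallai_transitive:
  assumes E: "finite E" "\<And>e. e \<in> E \<Longrightarrow> card e = 2"
    and ut: "\<And>N. maximum_matching E N \<Longrightarrow> u \<in> \<Union>N \<or> t \<in> \<Union>N"
    and tv: "\<And>N. maximum_matching E N \<Longrightarrow> t \<in> \<Union>N \<or> v \<in> \<Union>N"
    and miss: "maximum_matching E N\<^sub>0" "t \<notin> \<Union>N\<^sub>0"
    and M: "maximum_matching E M" "u \<notin> \<Union>M"
    and uv: "u \<noteq> v"
  shows "v \<in> \<Union>M"
proof (rule ccontr)
  assume v: "v \<notin> \<Union>M"
  define good where "good N \<longleftrightarrow> maximum_matching E N \<and> t \<notin> \<Union>N" for N
  have "finite M"
    using M E matching_finite by (auto simp: maximum_matching_def)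
  \<comment> \<open>Among the maximum matchings missing \<open>t\<close>, choose one that shares as
    many edges with \<open>M\<close> as possible; the contradiction is another one that shares
    more.\<close>
  have "\<forall>N. good N \<longrightarrow> card (M \<inter> N) < Suc (card M)"
    using \<open>finite M\<close> by (auto intro: card_mono le_imp_less_Suc)
  then obtain N where N: "good N" and max: "\<And>N'. good N' \<Longrightarrow> card (M \<inter> N') \<le> card (M \<inter> N)"
    using ex_has_greatest_nat[of good N\<^sub>0 "\<lambda>N. card (M \<inter> N)" "Suc (card M)"] miss
    unfolding good_def by (metis less_imp_le_nat)
  have mN: "matching E N" "card N = matching_number E" and mM: "matching E M" "card M = card N"
    and t: "t \<notin> \<Union>N"
    using N M by (auto simp: good_def maximum_matching_def)
  have finN: "finite N"
    using mN E matching_finite by auto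
  have inE: "M \<subseteq> E" "N \<subseteq> E"
    using mN mM by (auto simp: matching_def)
  have fin: "finite (\<Union>M)" "finite (\<Union>N)"
    using inE E \<open>finite M\<close> finN by (metis card.infinite finite_Union subsetD zero_neq_numeral)+
  have uN: "u \<in> \<Union>N" "v \<in> \<Union>N"
    using ut tv N t by (auto simp: good_def)
  \<comment> \<open>Both matchings cover equally many vertices, and \<open>u\<close>,
    \<open>v\<close> are covered by \<open>N\<close> only. So at least two vertices are covered by
    \<open>M\<close> only, and one of them differs from \<open>t\<close>.\<close>
  have "card (\<Union>M) = card (\<Union>N)"
    using matching_card_Union[OF mM(1) E(2)] matching_card_Union[OF mN(1) E(2)] mM by simp
  hence "card (\<Union>M - \<Union>N) = card (\<Union>N - \<Union>M)"
    using fin by (metis card_le_sym_Diff le_antisym order_refl)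
  also have "\<dots> \<ge> card {u, v}"
    by (rule card_mono) (use fin uN v M in auto)
  finally have "card (\<Union>M - \<Union>N) \<ge> 2"
    using uv by simp
  hence "\<not> \<Union>M - \<Union>N \<subseteq> {t}"
    using card_mono[of "{t}" "\<Union>M - \<Union>N"] by auto
  then obtain x where x: "x \<in> \<Union>M" "x \<notin> \<Union>N" "x \<noteq> t"
    by blast
  then obtain e where e: "e \<in> M" "x \<in> e"
    by auto
  then obtain y where y: "e = {x, y}" "x \<noteq> y"
    using E(2) inE by (meson edge_other_end subsetD)
  have "y \<in> \<Union>N"
  proof (rule ccontr)
    assume "y \<notin> \<Union>N"
    hence "matching E (insert e N)"
      using e inE y x by (intro matching_insert[OF mN(1)]) auto
    from card_le_matching_number[OF E(1) this] show False
      using mN(2) finN e x by (auto simp: card_insert_if split: if_splits)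
  qed
  then obtain f where f: "f \<in> N" "y \<in> f"
    by auto
  \<comment> \<open>Exchanging \<open>f\<close> for \<open>e\<close> keeps the size and still misses
    \<open>t\<close>, but gains a common edge with \<open>M\<close>: as \<open>f\<close> meets
    \<open>e\<close> in \<open>y\<close>, it is not in \<open>M\<close>.\<close>
  define N' where "N' = insert e (N - {f})"
  have "matching E N'"
    unfolding N'_def
  proof (rule matching_insert)
    show "matching E (N - {f})"
      by (rule matching_subset[OF mN(1)]) auto
    show "e \<inter> \<Union>(N - {f}) = {}"
      using matching_unique[OF mN(1) f(1) _ f(2)] y x by auto
  qed (use e inE in auto)
  moreover have eN: "e \<notin> N"
    using e x by auto
  have "card N' = Suc (card (N - {f}))"
    using eN finN by (simp add: N'_def del: card_Diff_insert)
  hence "card N' = card N"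
    using card_Suc_Diff1[OF finN f(1)] by simp
  moreover have "t \<notin> \<Union>N'"
    using t \<open>y \<in> \<Union>N\<close> x y by (auto simp: N'_def)
  ultimately have "good N'"
    using mN by (simp add: good_def maximum_matching_def)
  moreover have "f \<notin> M"
    using matching_unique[OF mM(1) e(1) _ _ f(2)] y eN f by auto
  hence "M \<inter> N' = insert e (M \<inter> N)"
    using e by (auto simp: N'_def)
  hence "card (M \<inter> N') = Suc (card (M \<inter> N))"
    using eN finN by simp
  ultimately show False
    using max[of N'] by simp
qed

text \<open>
  The nontrivial half of the Tutte--Berge formula, in Edmonds' form. Neither disjointness of the
  sets in \<open>P\<close> nor that they avoid \<open>W\<close> matters below.
\<close>

theorem odd_set_cover:
  assumes "finite E" "\<And>e. e \<in> E \<Longrightarrow> card e = 2"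
  shows "\<exists>N W P. matching E N \<and> finite W \<and> finite P \<and> (\<forall>C\<in>P. finite C) \<and>
           (\<forall>e\<in>E. e \<inter> W \<noteq> {} \<or> (\<exists>C\<in>P. e \<subseteq> C)) \<and>
           card W + (\<Sum>C\<in>P. card C div 2) \<le> card N"
  using assms
proof (induction "card E" arbitrary: E rule: less_induct)
  case less
  note E = less.prems
  obtain M where M: "matching E M" "card M = matching_number E"
    using maximum_matching_exists[OF E(1)] .
  have finV: "finite (\<Union>E)"
    using E by (metis card.infinite finite_Union zero_neq_numeral)
  show ?case
  \<comment> \<open>A vertex covered by every maximum matching goes into \<open>W\<close>, and
    induction handles the rest. If there is none, \<open>W\<close> is empty and the classes of
    Gallai's relation form \<open>P\<close>.\<close>
  proof (cases "\<exists>v\<in>\<Union>E. \<forall>N. maximum_matching E N \<longrightarrow> v \<in> \<Union>N")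
    case True
    then obtain v where v: "v \<in> \<Union>E" "\<And>N. maximum_matching E N \<Longrightarrow> v \<in> \<Union>N"
      by blast
    define E' where "E' = {e\<in>E. v \<notin> e}"
    have "E' \<subset> E"
      using v(1) by (auto simp: E'_def)
    hence "card E' < card E"
      using E(1) by (simp add: psubset_card_mono)
    from less.hyps[OF this] E obtain N W P where
      IH: "matching E' N" "finite W" "finite P" "\<forall>C\<in>P. finite C"
        "\<forall>e\<in>E'. e \<inter> W \<noteq> {} \<or> (\<exists>C\<in>P. e \<subseteq> C)"
        "card W + (\<Sum>C\<in>P. card C div 2) \<le> card N"
      unfolding E'_def by auto
    have N: "matching E N"
      using IH(1) \<open>E' \<subset> E\<close> by (auto intro: matching_mono)
    \<comment> \<open>Missing \<open>v\<close>, the matching \<open>N\<close> is not maximum in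
      \<open>E\<close>; the additional edge of \<open>M\<close> pays for \<open>v\<close>.\<close>
    have "v \<notin> \<Union>N"
      using IH(1) by (auto simp: matching_def E'_def)
    hence "card N \<noteq> card M"
      using v(2)[of N] N M by (auto simp: maximum_matching_def)
    hence "card N < card M"
      using card_le_matching_number[OF E(1) N] M by simp
    moreover have "card (insert v W) \<le> Suc (card W)"
      by (rule card_insert_le_m1) auto
    ultimately have "card (insert v W) + (\<Sum>C\<in>P. card C div 2) \<le> card M"
      using IH(6) by linarith
    moreover have "\<forall>e\<in>E. e \<inter> insert v W \<noteq> {} \<or> (\<exists>C\<in>P. e \<subseteq> C)"
      using IH(5) by (auto simp: E'_def)
    ultimately show ?thesis
      using IH(3,4) M(1) finite.insertI[OF IH(2)]
      by (intro exI[of _ M] exI[of _ "insert v W"] exI[of _ P] conjI)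
  next
    case False
    \<comment> \<open>Equality is a separate disjunct: here every vertex is missed by some maximum
      matching, so the other one fails for \<open>u = v\<close>.\<close>
    define r where "r = {(u, v). u \<in> \<Union>E \<and> v \<in> \<Union>E \<and>
      (u = v \<or> (\<forall>N. maximum_matching E N \<longrightarrow> u \<in> \<Union>N \<or> v \<in> \<Union>N))}"
    have r_trans: "(u, v) \<in> r" if "(u, t) \<in> r" "(t, v) \<in> r" for u t v
    proof (cases "u = t \<or> t = v \<or> u = v")
      case True
      thus ?thesis using that by (auto simp: r_def)
    next
      case ne: False
      have V: "u \<in> \<Union>E" "t \<in> \<Union>E" "v \<in> \<Union>E"
        and ut: "\<And>N. maximum_matching E N \<Longrightarrow> u \<in> \<Union>N \<or> t \<in> \<Union>N"
        and tv: "\<And>N. maximum_matching E N \<Longrightarrow> t \<in> \<Union>N \<or> v \<in> \<Union>N"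
        using that ne by (simp_all add: r_def del: Union_iff)
      obtain N\<^sub>0 where N0: "maximum_matching E N\<^sub>0" "t \<notin> \<Union>N\<^sub>0"
        using False V by blast
      have "u \<in> \<Union>N \<or> v \<in> \<Union>N" if "maximum_matching E N" for N
        using gallai_transitive[OF E ut tv N0 that] ne by blast
      thus ?thesis
        using V by (simp add: r_def)
    qed
    have r: "equiv (\<Union>E) r"
    proof (rule equivI)
      show "trans r"
        using r_trans by (blast intro: transI)
    qed (auto simp: refl_on_def r_def sym_def)
    \<comment> \<open>A maximum matching that misses both ends of an edge could be enlarged by it.
      Hence no edge leaves a class.\<close>
    have adj: "(u, v) \<in> r" if "e \<in> E" "u \<in> e" "v \<in> e" for u v e
    proof -
      have "u \<in> \<Union>N \<or> v \<in> \<Union>N" if N: "maximum_matching E N" and "u \<noteq> v" for N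
      proof (rule ccontr)
        assume *: "\<not> (u \<in> \<Union>N \<or> v \<in> \<Union>N)"
        have e: "e = {u, v}"
          using edge_other_end[OF E(2)[OF \<open>e \<in> E\<close>] \<open>u \<in> e\<close>] \<open>v \<in> e\<close> \<open>u \<noteq> v\<close>
          by auto
        have mN: "matching E N" "card N = matching_number E"
          using N by (auto simp: maximum_matching_def)
        have "matching E (insert e N)"
          by (rule matching_insert) (use mN \<open>e \<in> E\<close> e * in auto)
        from card_le_matching_number[OF E(1) this] show False
          using mN matching_finite[OF E(1) mN(1)] * e by (auto simp: card_insert_if split: if_splits)
      qed
      thus ?thesis
        using that by (auto simp: r_def)
    qed
    define P where "P = \<Union>E // r"
    have finP: "finite P"
      unfolding P_def using finV r by (intro finite_quotient) (auto simp: equiv_def r_def)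
    have CV: "C \<subseteq> \<Union>E" if "C \<in> P" for C
      using that r in_quotient_imp_subset unfolding P_def by blast
    have finC: "finite C" if "C \<in> P" for C
      using CV[OF that] finV finite_subset by blast
    have edge_in: "e \<subseteq> C" if "e \<in> E" "C \<in> P" "v \<in> e" "v \<in> C" for e C v
      using adj[OF that(1,3)] in_quotient_imp_closed[OF r _ that(4)] that(2)
      unfolding P_def by blast
    \<comment> \<open>\<open>M\<close> misses at most one vertex of a class and covers the others by
      edges inside the class.\<close>
    have half: "card C div 2 \<le> card {e\<in>M. e \<subseteq> C}" if C: "C \<in> P" for C
    proof -
      define S where "S = {e\<in>M. e \<subseteq> C}"
      have cS: "card (\<Union>S) = 2 * card S"
        by (rule matching_card_Union[OF matching_subset[OF M(1)] E(2)]) (auto simp: S_def)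
      have inS: "v \<in> \<Union>S" if "v \<in> C" "v \<in> \<Union>M" for v
        using that edge_in[OF _ C] M(1) by (auto simp: S_def matching_def)
      have missed: "u = v" if "u \<in> C - \<Union>S" "v \<in> C - \<Union>S" for u v
      proof -
        have "(u, v) \<in> r"
          using that C r quotient_eq_iff[OF r] unfolding P_def by blast
        moreover have "u \<notin> \<Union>M" "v \<notin> \<Union>M" "maximum_matching E M"
          using that inS M by (auto simp: maximum_matching_def)
        ultimately show ?thesis
          unfolding r_def by blast
      qed
      have "card (C - \<Union>S) \<le> 1"
        using missed finC[OF C] by (auto simp: card_le_Suc0_iff_eq)
      moreover have "card C \<le> card (\<Union>S) + card (C - \<Union>S)"
      proof -
        have "\<Union>S \<subseteq> C"
          by (auto simp: S_def)
        thus ?thesis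
          using finC[OF C] by (simp add: card_Diff_subset finite_subset)
      qed
      ultimately show ?thesis
        using cS unfolding S_def by linarith
    qed
    have "(\<Sum>C\<in>P. card C div 2) \<le> (\<Sum>C\<in>P. card {e\<in>M. e \<subseteq> C})"
      by (rule sum_mono) (rule half)
    \<comment> \<open>Classes are disjoint, so no edge of \<open>M\<close> is counted twice.\<close>
    also have "\<dots> = card (\<Union>C\<in>P. {e\<in>M. e \<subseteq> C})"
    proof (rule card_UN_disjoint[symmetric])
      show "\<forall>C\<in>P. finite {e\<in>M. e \<subseteq> C}"
        using matching_finite[OF E(1) M(1)] by auto
      show "\<forall>C\<in>P. \<forall>D\<in>P. C \<noteq> D \<longrightarrow> {e\<in>M. e \<subseteq> C} \<inter> {e\<in>M. e \<subseteq> D} = {}"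
      proof (intro ballI impI equals0I)
        fix C D e
        assume "C \<in> P" "D \<in> P" "C \<noteq> D" and e: "e \<in> {e\<in>M. e \<subseteq> C} \<inter> {e\<in>M. e \<subseteq> D}"
        hence "C \<inter> D = {}"
          using quotient_disj[OF r] unfolding P_def by blast
        moreover have "e \<noteq> {}"
          using E(2)[of e] M(1) e by (auto simp: matching_def)
        ultimately show False
          using e by blast
      qed
    qed (fact finP)
    also have "\<dots> \<le> card M"
      by (rule card_mono) (use matching_finite[OF E(1) M(1)] in auto)
    finally have "card ({} :: nat set) + (\<Sum>C\<in>P. card C div 2) \<le> card M"
      by simp
    moreover have "\<exists>C\<in>P. e \<subseteq> C" if e: "e \<in> E" for e
    proof -
      obtain v where v: "v \<in> e"
        using E(2)[OF e] by fastforce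
      hence "v \<in> \<Union>E"
        using e by blast
      then obtain C where "C \<in> P" "v \<in> C"
        using Union_quotient[OF r] unfolding P_def by blast
      thus ?thesis
        using edge_in[OF e _ v] by blast
    qed
    ultimately show ?thesis
      using M(1) finP finC
      by (intro exI[of _ M] exI[of _ "{}"] exI[of _ P] conjI ballI disjI2) simp_all
  qed
qed

text \<open>
  Edmonds' matching polytope, up to a factor: a fractional matching that violates the odd set
  constraints by at most \<open>1 + \<delta>\<close> loses at most that factor when it is made integral.
\<close>

lemma integral_matching:
  fixes x :: "edge \<Rightarrow> real"
  assumes E: "finite E" "\<And>e. e \<in> E \<Longrightarrow> card e = 2"
    and x: "\<And>e. e \<in> E \<Longrightarrow> 0 \<le> x e" "0 \<le> \<delta>"
    and load: "\<And>v. (\<Sum>e | e \<in> E \<and> v \<in> e. x e) \<le> 1"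
    and odd: "\<And>C. finite C \<Longrightarrow> (\<Sum>e | e \<in> E \<and> e \<subseteq> C. x e) \<le> (1 + \<delta>) * real (card C div 2)"
  shows "\<exists>N. matching E N \<and> sum x E \<le> (1 + \<delta>) * real (card N)"
proof -
  obtain N W P where N: "matching E N" and fin: "finite W" "finite P" "\<forall>C\<in>P. finite C"
    and cover: "\<forall>e\<in>E. e \<inter> W \<noteq> {} \<or> (\<exists>C\<in>P. e \<subseteq> C)"
    and card: "card W + (\<Sum>C\<in>P. card C div 2) \<le> card N"
    using odd_set_cover[OF E] by metis
  \<comment> \<open>Weak duality: each edge is charged at least once to a vertex of \<open>W\<close>
    or a set of \<open>P\<close> that covers it. Exchanging the sums leaves the vertex and odd set
    constraints.\<close>
  have "sum x E \<le> (\<Sum>e\<in>E. (\<Sum>v | v \<in> W \<and> v \<in> e. x e) + (\<Sum>C | C \<in> P \<and> e \<subseteq> C. x e))"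
  proof (rule sum_mono)
    fix e assume e: "e \<in> E"
    have ge: "x e \<le> (\<Sum>i\<in>I. x e)" if "finite I" "i \<in> I" for i and I :: "'i set"
    proof -
      have "1 \<le> card I"
        using that by (metis Suc_leI card_gt_0_iff empty_iff One_nat_def)
      thus ?thesis
        using x(1)[OF e] by (simp add: mult_le_cancel_right1)
    qed
    have nonneg: "0 \<le> (\<Sum>i\<in>I. x e)" for I :: "'i set"
      using x(1)[OF e] by (simp add: sum_nonneg)
    consider v where "v \<in> W" "v \<in> e" | C where "C \<in> P" "e \<subseteq> C"
      using cover e by blast
    thus "x e \<le> (\<Sum>v | v \<in> W \<and> v \<in> e. x e) + (\<Sum>C | C \<in> P \<and> e \<subseteq> C. x e)"
    proof cases
      case 1
      have "x e \<le> (\<Sum>v | v \<in> W \<and> v \<in> e. x e)"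
        by (rule ge[of _ v]) (use 1 fin in auto)
      thus ?thesis
        using nonneg[of "{C. C \<in> P \<and> e \<subseteq> C}"] by linarith
    next
      case 2
      have "x e \<le> (\<Sum>C | C \<in> P \<and> e \<subseteq> C. x e)"
        by (rule ge[of _ C]) (use 2 fin in auto)
      thus ?thesis
        using nonneg[of "{v. v \<in> W \<and> v \<in> e}"] by linarith
    qed
  qed
  also have "\<dots> = (\<Sum>v\<in>W. \<Sum>e | e \<in> E \<and> v \<in> e. x e) + (\<Sum>C\<in>P. \<Sum>e | e \<in> E \<and> e \<subseteq> C. x e)"
    unfolding sum.distrib
    using sum.swap_restrict[OF fin(1) E(1), of "\<lambda>v e. x e" "\<lambda>v e. v \<in> e"]
      sum.swap_restrict[OF fin(2) E(1), of "\<lambda>C e. x e" "\<lambda>C e. e \<subseteq> C"] by simp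
  also have "\<dots> \<le> (\<Sum>v\<in>W. 1) + (\<Sum>C\<in>P. (1 + \<delta>) * real (card C div 2))"
    using fin load odd by (intro add_mono sum_mono) auto
  also have "\<dots> \<le> (1 + \<delta>) * real (card W) + (1 + \<delta>) * real (\<Sum>C\<in>P. card C div 2)"
    using x(2) by (simp add: sum_distrib_left algebra_simps)
  also have "\<dots> = (1 + \<delta>) * real (card W + (\<Sum>C\<in>P. card C div 2))"
    by (simp add: algebra_simps)
  also have "\<dots> \<le> (1 + \<delta>) * real (card N)"
    using card x(2) by (intro mult_left_mono) (simp_all del: of_nat_add of_nat_sum)
  finally show ?thesis
    using N by blast
qed

section \<open>Degree-bounded extensions of a maximal matching\<close>

definition degree :: "edge set \<Rightarrow> nat \<Rightarrow> nat" where
  "degree H v = card {e\<in>H. v \<in> e}"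

definition capacity :: "edge set \<Rightarrow> nat \<Rightarrow> nat \<Rightarrow> nat \<Rightarrow> nat" where
  "capacity M a b v = (if v \<in> \<Union>M then a else b)"

definition crossing :: "edge set \<Rightarrow> edge \<Rightarrow> bool" where
  "crossing M e \<longleftrightarrow> card (e \<inter> \<Union>M) = 1"

text \<open>Only one edge of \<open>M\<close> can contain \<open>v\<close>, so \<open>S\<close> has
  at most one element.\<close>

lemma sum_matching_edge_le:
  fixes g :: "edge \<Rightarrow> nat"
  assumes "finite E" "matching E M" "S \<subseteq> {e\<in>M. v \<in> e}" "\<And>e. e \<in> S \<Longrightarrow> g e \<le> c"
  shows "sum g S \<le> c"
proof (cases "S = {}")
  case False
  then obtain e where "e \<in> S"
    by blast
  hence "S = {e}"
    using assms(3) matching_unique[OF assms(2), of _ e v] by blast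
  thus ?thesis
    using assms(4) by simp
qed simp

text \<open>This is what the two passes guarantee about the stored edges, separated from the memory.
  The last inequality is \<open>(a + b)\<^sup>2 \<le> 2 * b\<^sup>2\<close>, that is,
  \<open>a / b \<le> sqrt 2 - 1\<close>.\<close>

locale extended_matching =
  fixes E M H :: "edge set" and a b :: nat
  assumes finE: "finite E" and card2: "\<And>e. e \<in> E \<Longrightarrow> card e = 2"
    and M: "matching E M" and maximal: "\<And>e. e \<in> E \<Longrightarrow> e \<inter> \<Union>M \<noteq> {}"
    and HE: "H \<subseteq> E" and H_crossing: "\<And>e. e \<in> H \<Longrightarrow> crossing M e"
    and degree_le: "\<And>v. degree H v \<le> capacity M a b v"
    and saturated: "\<And>e. e \<in> E \<Longrightarrow> crossing M e \<Longrightarrow>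
      e \<in> H \<or> (\<exists>v\<in>e. capacity M a b v \<le> degree H v)"
    and ab: "0 < a" "a \<le> b" "a * a + 2 * a * b \<le> b * b"
begin

abbreviation "deg \<equiv> degree H"
abbreviation "cap \<equiv> capacity M a b"

text \<open>The amount by which the weight of \<open>e\<close> can be raised before one end is full.
  By \<open>degree_le\<close> the subtraction of natural numbers is never truncated.\<close>

definition slack :: "edge \<Rightarrow> nat" where
  "slack e = Min ((\<lambda>v. cap v - deg v) ` e)"

text \<open>
  \<open>weight Opt / b\<close> is a fractional matching of \<open>M \<union> H\<close>. The edges of \<open>H\<close> are almost weightless, so
  that odd sets are harmless; edges of the optimum \<open>Opt\<close> that made it into \<open>H\<close> are raised until one
  end reaches its capacity, just as if \<open>H\<close> had rejected them.
\<close>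

definition weight :: "edge set \<Rightarrow> edge \<Rightarrow> nat" where
  "weight Opt e = (if e \<in> M then b - a else 1 + (if e \<in> Opt then slack e else 0))"

lemma ME: "M \<subseteq> E"
  using M by (simp add: matching_def)

lemma finM: "finite M" and finH: "finite H"
  using ME HE finE by (auto intro: finite_subset)

lemma fin_edge: "e \<in> E \<Longrightarrow> finite e"
  using card2 by (metis card.infinite zero_neq_numeral)

lemma finV: "finite (\<Union>E)"
  using finE fin_edge by auto

lemma M_H_disjoint: "M \<inter> H = {}"
proof -
  have "card (e \<inter> \<Union>M) = 2" if "e \<in> M" for e
  proof -
    have "e \<inter> \<Union>M = e"
      using that by blast
    thus ?thesis
      using card2[of e] ME that by auto
  qed
  thus ?thesis
    using H_crossing by (fastforce simp: crossing_def)
qed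

lemma crossing_edge:
  assumes "e \<in> E" "crossing M e"
  obtains u v where "e = {u, v}" "u \<noteq> v" "u \<in> \<Union>M" "v \<notin> \<Union>M"
proof -
  obtain u where u: "e \<inter> \<Union>M = {u}"
    using assms(2) by (auto simp: crossing_def card_1_singleton_iff)
  hence "u \<in> e"
    by blast
  then obtain v where v: "e = {u, v}" "u \<noteq> v"
    using edge_other_end[OF card2[OF assms(1)]] by metis
  have "v \<notin> \<Union>M"
  proof
    assume "v \<in> \<Union>M"
    hence "v \<in> e \<inter> \<Union>M"
      using v by blast
    thus False
      unfolding u using v by simp
  qed
  thus ?thesis
    using that[OF v] u by blast
qed

lemma slack_le: "e \<in> E \<Longrightarrow> v \<in> e \<Longrightarrow> slack e \<le> cap v - deg v"
  unfolding slack_def using fin_edge by (intro Min_le) auto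

lemma slack_attained:
  assumes "e \<in> E"
  obtains v where "v \<in> e" "slack e = cap v - deg v"
proof -
  have "e \<noteq> {}"
    using card2[OF assms] by auto
  hence "slack e \<in> (\<lambda>v. cap v - deg v) ` e"
    unfolding slack_def using fin_edge[OF assms] by (intro Min_in) auto
  thus ?thesis
    using that by auto
qed

lemma slack_le_a:
  assumes "e \<in> H"
  shows "slack e \<le> a"
proof -
  have e: "e \<in> E"
    using assms HE by blast
  obtain u v where "e = {u, v}" "u \<in> \<Union>M"
    using crossing_edge[OF e H_crossing[OF assms]] .
  thus ?thesis
    using slack_le[OF e, of u] by (auto simp: capacity_def)
qed

section \<open>Vertex constraints for the weights\<close>

lemma weight_H: "e \<in> H \<Longrightarrow> weight Opt e = 1 + (if e \<in> Opt then slack e else 0)"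
  using M_H_disjoint by (auto simp: weight_def)

lemma H_load_eq:
  "(\<Sum>e | e \<in> H \<and> v \<in> e. weight Opt e) = deg v + (\<Sum>e | e \<in> H \<inter> Opt \<and> v \<in> e. slack e)"
proof -
  have "(\<Sum>e | e \<in> H \<and> v \<in> e. weight Opt e) =
      (\<Sum>e | e \<in> H \<and> v \<in> e. 1 + (if e \<in> Opt then slack e else 0))"
    by (intro sum.cong) (auto simp: weight_H)
  also have "\<dots> = deg v + (\<Sum>e\<in>{e\<in>H. v \<in> e} \<inter> Opt. slack e)"
    unfolding sum.distrib using finH by (simp add: degree_def sum.inter_restrict)
  also have "{e\<in>H. v \<in> e} \<inter> Opt = {e. e \<in> H \<inter> Opt \<and> v \<in> e}"
    by blast
  finally show ?thesis .
qed

text \<open>At most one edge of \<open>Opt\<close> contains \<open>v\<close>, and it is raised by no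
  more than the room left at \<open>v\<close>.\<close>

lemma H_load_le:
  assumes "matching E Opt"
  shows "(\<Sum>e | e \<in> H \<and> v \<in> e. weight Opt e) \<le> cap v"
proof -
  have "(\<Sum>e | e \<in> H \<inter> Opt \<and> v \<in> e. slack e) \<le> cap v - deg v"
    by (rule sum_matching_edge_le[OF finE assms]) (use slack_le HE in auto)
  thus ?thesis
    using degree_le[of v] unfolding H_load_eq by linarith
qed

text \<open>A vertex of \<open>\<Union>M\<close> bears \<open>b - a\<close> from its edge of
  \<open>M\<close> and at most \<open>a\<close> from \<open>H\<close>; any other vertex bears only
  weight of \<open>H\<close>, at most \<open>b\<close>.\<close>

lemma load_le:
  assumes "matching E Opt"
  shows "(\<Sum>e | e \<in> M \<union> H \<and> v \<in> e. weight Opt e) \<le> b"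
proof -
  have "{e. e \<in> M \<union> H \<and> v \<in> e} = {e. e \<in> M \<and> v \<in> e} \<union> {e. e \<in> H \<and> v \<in> e}"
    by blast
  hence "(\<Sum>e | e \<in> M \<union> H \<and> v \<in> e. weight Opt e) =
      (\<Sum>e | e \<in> M \<and> v \<in> e. weight Opt e) + (\<Sum>e | e \<in> H \<and> v \<in> e. weight Opt e)"
    using finM finH M_H_disjoint by (subst sum.union_disjoint[symmetric]) auto
  moreover have "(\<Sum>e | e \<in> M \<and> v \<in> e. weight Opt e) \<le> b - a"
    by (rule sum_matching_edge_le[OF finE M]) (auto simp: weight_def)
  moreover have "(\<Sum>e | e \<in> M \<and> v \<in> e. weight Opt e) = 0" if "v \<notin> \<Union>M"
    using that by (intro sum.neutral) auto
  ultimately show ?thesis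
    using H_load_le[OF assms, of v] ab(2) by (auto simp: capacity_def split: if_splits)
qed

section \<open>Lower bound on the total weight\<close>

text \<open>Raising a kept edge by its slack fills the end at which the slack is attained. A
  rejected edge has a saturated end by \<open>saturated\<close>, and raising other edges does not
  lower the load there.\<close>

lemma crossing_load:
  assumes "e \<in> E" "e \<in> Opt" "crossing M e"
  shows "\<exists>v\<in>e. cap v \<le> (\<Sum>e | e \<in> H \<and> v \<in> e. weight Opt e)"
proof (cases "e \<in> H")
  case True
  obtain v where v: "v \<in> e" "slack e = cap v - deg v"
    using slack_attained[OF assms(1)] .
  have "slack e \<le> (\<Sum>e | e \<in> H \<inter> Opt \<and> v \<in> e. slack e)"
    by (rule member_le_sum) (use True assms v finH in auto)
  thus ?thesis
    using v unfolding H_load_eq by (intro bexI[of _ v]) auto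
next
  case False
  thus ?thesis
    using saturated[OF assms(1,3)] unfolding H_load_eq by (auto intro: trans_le_add1)
qed

text \<open>By maximality an edge of \<open>Opt\<close> uses one vertex of \<open>\<Union>M\<close>
  if it is crossing and two otherwise. Different edges use different vertices, of which there are
  \<open>2 * card M\<close>.\<close>

lemma card_crossing_ge:
  assumes "matching E Opt"
  shows "2 * card Opt \<le> card {e\<in>Opt. crossing M e} + 2 * card M"
proof -
  have Opt: "Opt \<subseteq> E" "finite Opt"
    using assms matching_finite[OF finE] by (auto simp: matching_def)
  have "2 * card Opt = (\<Sum>e\<in>Opt. 2)"
    by simp
  also have "\<dots> \<le> (\<Sum>e\<in>Opt. (if crossing M e then 1 else 0) + card (e \<inter> \<Union>M))"
  proof (rule sum_mono)
    fix e assume "e \<in> Opt"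
    hence "e \<in> E"
      using Opt by blast
    hence "card (e \<inter> \<Union>M) \<noteq> 0"
      using maximal fin_edge by simp
    thus "2 \<le> (if crossing M e then 1 else 0) + card (e \<inter> \<Union>M)"
      by (auto simp: crossing_def)
  qed
  also have "\<dots> = card {e\<in>Opt. crossing M e} + (\<Sum>e\<in>Opt. card (e \<inter> \<Union>M))"
    unfolding sum.distrib using Opt by (simp add: sum.If_cases Collect_conj_eq Int_commute)
  also have "(\<Sum>e\<in>Opt. card (e \<inter> \<Union>M)) = card (\<Union>e\<in>Opt. e \<inter> \<Union>M)"
  proof (rule card_UN_disjoint[symmetric])
    show "\<forall>e\<in>Opt. \<forall>f\<in>Opt. e \<noteq> f \<longrightarrow> e \<inter> \<Union>M \<inter> (f \<inter> \<Union>M) = {}"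
      using matching_disjoint[OF assms] by blast
  qed (use Opt fin_edge in auto)
  also have "\<dots> \<le> card (\<Union>M)"
    using finite_subset[OF Union_mono[OF ME] finV] by (intro card_mono) auto
  finally show ?thesis
    using matching_card_Union[OF M card2] by simp
qed

text \<open>Every crossing edge of \<open>Opt\<close> has an end at capacity: charge \<open>1\<close> to the two sides.\<close>

lemma H_weight_ge:
  assumes "matching E Opt"
  shows "card {e\<in>Opt. crossing M e} * (a * b) \<le> (\<Sum>e\<in>H. weight Opt e) * (a + b)"
proof -
  define h where "h v = (\<Sum>e | e \<in> H \<and> v \<in> e. weight Opt e)" for v
  \<comment> \<open>\<open>c v\<close> is \<open>a * b / cap v\<close>, so a full vertex has
    \<open>h v * c v \<ge> a * b\<close>. An edge of \<open>H\<close> has one end of each kind,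
    hence the factor \<open>a + b\<close> after double counting.\<close>
  define c where "c v = (if v \<in> \<Union>M then b else a)" for v
  have cap_c: "cap v * c v = a * b" for v
    by (simp add: capacity_def c_def)
  define Q where "Q = {e\<in>Opt. crossing M e}"
  have Q: "Q \<subseteq> E" "finite Q"
    using assms matching_finite[OF finE] by (auto simp: matching_def Q_def)
  have "card Q * (a * b) = (\<Sum>e\<in>Q. a * b)"
    by simp
  also have "\<dots> \<le> (\<Sum>e\<in>Q. \<Sum>v\<in>e. h v * c v)"
  proof (rule sum_mono)
    fix e assume e: "e \<in> Q"
    then obtain v where v: "v \<in> e" "cap v \<le> h v"
      using crossing_load[of e Opt] Q by (auto simp: Q_def h_def)
    have "a * b \<le> h v * c v"
      using v(2) cap_c[of v] by (metis mult_le_mono1)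
    also have "\<dots> \<le> (\<Sum>v\<in>e. h v * c v)"
      by (rule member_le_sum) (use v e Q fin_edge in auto)
    finally show "a * b \<le> (\<Sum>v\<in>e. h v * c v)" .
  qed
  also have "\<dots> = (\<Sum>v\<in>\<Union>Q. h v * c v)"
    by (rule sum.Union_disjoint[symmetric, unfolded comp_def])
       (use Q fin_edge matching_disjoint[OF assms] in \<open>auto simp: Q_def\<close>)
  also have "\<dots> \<le> (\<Sum>v\<in>\<Union>E. h v * c v)"
    by (rule sum_mono2) (use finV Q in auto)
  also have "\<dots> = (\<Sum>v\<in>\<Union>E. \<Sum>e | e \<in> H \<and> v \<in> e. weight Opt e * c v)"
    by (simp add: h_def sum_distrib_right)
  also have "\<dots> = (\<Sum>e\<in>H. \<Sum>v | v \<in> \<Union>E \<and> v \<in> e. weight Opt e * c v)"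
    by (rule sum.swap_restrict[OF finV finH])
  also have "\<dots> = (\<Sum>e\<in>H. weight Opt e * (a + b))"
  proof (rule sum.cong)
    fix e assume e: "e \<in> H"
    hence "e \<in> E"
      using HE by blast
    then obtain u v where uv: "e = {u, v}" "u \<noteq> v" "u \<in> \<Union>M" "v \<notin> \<Union>M"
      using crossing_edge H_crossing[OF e] by metis
    have "{v. v \<in> \<Union>E \<and> v \<in> e} = {u, v}"
      using uv \<open>e \<in> E\<close> by blast
    thus "(\<Sum>v | v \<in> \<Union>E \<and> v \<in> e. weight Opt e * c v) = weight Opt e * (a + b)"
      using uv by (simp add: c_def algebra_simps del: Union_iff)
  qed simp
  finally show ?thesis
    by (simp add: Q_def sum_distrib_right)
qed

text \<open>After scaling by \<open>a + b\<close>, each edge of \<open>M\<close> yields at least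
  \<open>2 * a * b\<close> and each crossing edge of \<open>Opt\<close> yields \<open>a * b\<close>.
  These are the proportions in \<open>card_crossing_ge\<close>, so the size of \<open>M\<close>
  drops out.\<close>

lemma total_weight_ge:
  assumes "matching E Opt"
  shows "2 * a * b * card Opt \<le> (\<Sum>e\<in>M \<union> H. weight Opt e) * (a + b)"
proof -
  let ?T = "\<Sum>e\<in>H. weight Opt e" and ?y = "card {e\<in>Opt. crossing M e}"
  have "(\<Sum>e\<in>M \<union> H. weight Opt e) = (\<Sum>e\<in>M. weight Opt e) + ?T"
    using finM finH M_H_disjoint by (rule sum.union_disjoint)
  also have "(\<Sum>e\<in>M. weight Opt e) = card M * (b - a)"
    by (simp add: weight_def)
  finally have sum_eq: "(\<Sum>e\<in>M \<union> H. weight Opt e) = card M * (b - a) + ?T" .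
  have "(\<Sum>e\<in>M \<union> H. weight Opt e) * (a + b) = card M * ((b - a) * (a + b)) + ?T * (a + b)"
    unfolding sum_eq by (simp only: add_mult_distrib mult.assoc)
  also have "\<dots> \<ge> card M * (2 * a * b) + ?y * (a * b)"
  proof (intro add_mono mult_le_mono2 H_weight_ge[OF assms])
    \<comment> \<open>The right side below is \<open>b\<^sup>2 - a\<^sup>2\<close>, so this is the
      last condition of \<open>ab\<close>; \<open>d\<close> removes the subtraction.\<close>
    obtain d where d: "b = a + d"
      using ab(2) le_Suc_ex by blast
    show "2 * a * b \<le> (b - a) * (a + b)"
      using ab(3) unfolding d by (simp add: algebra_simps)
  qed
  moreover have "2 * card Opt * (a * b) \<le> (?y + 2 * card M) * (a * b)"
    using card_crossing_ge[OF assms] by (rule mult_le_mono1)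
  ultimately show ?thesis
    by (simp add: algebra_simps)
qed

section \<open>Odd set constraints for the weights\<close>

text \<open>Summing the loads over \<open>C\<close> counts each inner edge twice. For even
  \<open>card C\<close> this is the wanted constraint; for odd \<open>card C\<close> it is too weak
  by \<open>b / 2\<close>.\<close>

lemma half_load:
  assumes "matching E Opt" "finite C"
  shows "2 * (\<Sum>e | e \<in> M \<union> H \<and> e \<subseteq> C. weight Opt e) \<le> b * card C"
proof -
  let ?K = "M \<union> H"
  have "2 * (\<Sum>e | e \<in> ?K \<and> e \<subseteq> C. weight Opt e) = (\<Sum>e | e \<in> ?K \<and> e \<subseteq> C. \<Sum>v | v \<in> C \<and> v \<in> e. weight Opt e)"
    unfolding sum_distrib_left
  proof (rule sum.cong)
    fix e assume e: "e \<in> {e. e \<in> ?K \<and> e \<subseteq> C}"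
    hence "{v. v \<in> C \<and> v \<in> e} = e" "card e = 2"
      using card2 ME HE by auto
    thus "2 * weight Opt e = (\<Sum>v | v \<in> C \<and> v \<in> e. weight Opt e)"
      by simp
  qed simp
  also have "\<dots> \<le> (\<Sum>e\<in>?K. \<Sum>v | v \<in> C \<and> v \<in> e. weight Opt e)"
    by (rule sum_mono2) (use finM finH in auto)
  also have "\<dots> = (\<Sum>v\<in>C. \<Sum>e | e \<in> ?K \<and> v \<in> e. weight Opt e)"
    by (rule sum.swap_restrict[symmetric]) (use assms finM finH in auto)
  also have "\<dots> \<le> (\<Sum>v\<in>C. b)"
    by (intro sum_mono load_le assms)
  finally show ?thesis
    by (simp add: mult.commute)
qed

text \<open>
  Without the unit weights on \<open>H\<close>, the weight inside \<open>C\<close> is at most \<open>b - a\<close> on each edge of one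
  matching plus at most \<open>a\<close> on each edge of another.
\<close>

lemma inner_weight:
  assumes "matching E Opt" "finite C"
  shows "(\<Sum>e | e \<in> M \<union> H \<and> e \<subseteq> C. weight Opt e) \<le> b * (card C div 2) + card {e\<in>H. e \<subseteq> C}"
proof -
  let ?k = "card C div 2"
  have "{e. e \<in> M \<union> H \<and> e \<subseteq> C} = {e\<in>M. e \<subseteq> C} \<union> {e\<in>H. e \<subseteq> C}"
    by blast
  hence "(\<Sum>e | e \<in> M \<union> H \<and> e \<subseteq> C. weight Opt e) =
      (\<Sum>e\<in>{e\<in>M. e \<subseteq> C}. weight Opt e) + (\<Sum>e\<in>{e\<in>H. e \<subseteq> C}. weight Opt e)"
    using finM finH M_H_disjoint by (subst sum.union_disjoint[symmetric]) auto
  moreover have "(\<Sum>e\<in>{e\<in>M. e \<subseteq> C}. weight Opt e) \<le> (b - a) * ?k"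
  proof -
    have "(\<Sum>e\<in>{e\<in>M. e \<subseteq> C}. weight Opt e) = card {e\<in>M. e \<subseteq> C} * (b - a)"
      by (simp add: weight_def)
    thus ?thesis
      using matching_within[OF M card2 assms(2)] by (simp add: mult.commute)
  qed
  moreover have "(\<Sum>e\<in>{e\<in>H. e \<subseteq> C}. weight Opt e) \<le> card {e\<in>H. e \<subseteq> C} + a * ?k"
  proof -
    have "(\<Sum>e\<in>{e\<in>H. e \<subseteq> C}. weight Opt e) =
        (\<Sum>e\<in>{e\<in>H. e \<subseteq> C}. 1 + (if e \<in> Opt then slack e else 0))"
      by (intro sum.cong) (auto simp: weight_H)
    also have "\<dots> = card {e\<in>H. e \<subseteq> C} + (\<Sum>e\<in>{e\<in>H. e \<subseteq> C} \<inter> Opt. slack e)"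
      unfolding sum.distrib using finH by (simp add: sum.inter_restrict)
    also have "(\<Sum>e\<in>{e\<in>H. e \<subseteq> C} \<inter> Opt. slack e) \<le> (\<Sum>e\<in>{e\<in>H. e \<subseteq> C} \<inter> Opt. a)"
      by (intro sum_mono slack_le_a) auto
    also have "\<dots> = a * card ({e\<in>H. e \<subseteq> C} \<inter> Opt)"
      by simp
    also have "card ({e\<in>H. e \<subseteq> C} \<inter> Opt) \<le> card {e\<in>Opt. e \<subseteq> C}"
      by (rule card_mono) (use matching_finite[OF finE assms(1)] in auto)
    also have "\<dots> \<le> ?k"
      by (rule matching_within[OF assms(1) card2 assms(2)])
    finally show ?thesis
      by simp
  qed
  moreover have "(b - a) * ?k + a * ?k = b * ?k"
    using ab(2) by (simp flip: add_mult_distrib)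
  ultimately show ?thesis
    by linarith
qed

text \<open>\<open>H\<close> is bipartite between \<open>\<Union>M\<close> and the other vertices,
  and its edges are determined by their ends.\<close>

lemma card_H_within:
  assumes "finite C"
  shows "card {e\<in>H. e \<subseteq> C} \<le> card (C \<inter> \<Union>M) * card (C - \<Union>M)"
proof -
  have "{e\<in>H. e \<subseteq> C} \<subseteq> (\<lambda>(u, v). {u, v}) ` ((C \<inter> \<Union>M) \<times> (C - \<Union>M))"
  proof
    fix e assume e: "e \<in> {e\<in>H. e \<subseteq> C}"
    then obtain u v where "e = {u, v}" "u \<in> \<Union>M" "v \<notin> \<Union>M"
      using crossing_edge H_crossing HE by (metis (no_types, lifting) mem_Collect_eq subsetD)
    thus "e \<in> (\<lambda>(u, v). {u, v}) ` ((C \<inter> \<Union>M) \<times> (C - \<Union>M))"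
      using e by (intro image_eqI[of _ _ "(u, v)"]) auto
  qed
  hence "card {e\<in>H. e \<subseteq> C} \<le> card ((C \<inter> \<Union>M) \<times> (C - \<Union>M))"
    using assms by (intro surj_card_le) auto
  thus ?thesis
    by (simp add: card_cartesian_product)
qed

text \<open>The allowed relative excess is \<open>1 / q\<close>. For odd sets with
  \<open>k < q\<close>, the excess in \<open>inner_weight\<close> is at most
  \<open>k * (k + 1) \<le> k * q = b * k / q\<close>. For \<open>k \<ge> q\<close>, the excess
  \<open>b / 2\<close> in \<open>half_load\<close> is at most
  \<open>b * k / (2 * q)\<close>.\<close>

lemma odd_set_weight:
  assumes "matching E Opt" "finite C" and b: "b = q * q" "0 < q"
  shows "q * (\<Sum>e | e \<in> M \<union> H \<and> e \<subseteq> C. weight Opt e) \<le> (q + 1) * (b * (card C div 2))"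
proof -
  let ?w = "\<Sum>e | e \<in> M \<union> H \<and> e \<subseteq> C. weight Opt e"
  define k where "k = card C div 2"
  show ?thesis
  proof (cases "even (card C)")
    case True
    hence "card C = 2 * k"
      by (simp add: k_def)
    hence "?w \<le> b * k"
      using half_load[OF assms(1,2)] by simp
    hence "q * ?w \<le> q * (b * k)"
      by (rule mult_le_mono2)
    also have "\<dots> \<le> (q + 1) * (b * k)"
      by simp
    finally show ?thesis
      by (simp only: k_def)
  next
    case False
    hence C: "card C = 2 * k + 1"
      by (simp add: k_def)
    show ?thesis
    proof (cases "k < q")
      case True
      define i where "i = card (C \<inter> \<Union>M)"
      have "i \<le> card C"
        unfolding i_def using assms(2) by (intro card_mono) auto
      have "card (C - \<Union>M) = card C - i"
        unfolding i_def using assms(2) by (simp add: card_Diff_subset_Int)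
      hence "card {e\<in>H. e \<subseteq> C} \<le> i * (card C - i)"
        using card_H_within[OF assms(2)] by (simp add: i_def)
      also have "\<dots> \<le> k * (k + 1)"
      proof -
        \<comment> \<open>A product of two numbers with sum \<open>2 * k + 1\<close> is largest for
          \<open>k\<close> and \<open>k + 1\<close>; \<open>r\<close> measures the distance from
          this balanced split.\<close>
        obtain j where j: "card C = i + j"
          using \<open>i \<le> card C\<close> le_Suc_ex by blast
        have "i * j \<le> k * (k + 1)"
        proof (cases "i \<le> k")
          case True
          then obtain r where "k = i + r" "j = i + 2 * r + 1"
            using j C le_Suc_ex by force
          thus ?thesis by (simp add: algebra_simps)
        next
          case False
          then obtain r where "k = j + r" "i = j + 2 * r + 1"
            using j C le_Suc_ex[of j k] by force
          thus ?thesis by (simp add: algebra_simps)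
        qed
        thus ?thesis
          using j by simp
      qed
      also have "\<dots> \<le> k * q"
        using True by (intro mult_le_mono2) simp
      finally have "?w \<le> b * k + k * q"
        using inner_weight[OF assms(1,2)] by (simp add: k_def)
      hence "q * ?w \<le> q * (b * k + k * q)"
        by (rule mult_le_mono2)
      thus ?thesis
        by (simp add: k_def b algebra_simps)
    next
      case False
      have "2 * ?w \<le> b * (2 * k + 1)"
        using half_load[OF assms(1,2)] C by simp
      hence "q * (2 * ?w) \<le> q * (b * (2 * k + 1))"
        by (rule mult_le_mono2)
      also have "\<dots> = 2 * q * b * k + b * q"
        by (simp add: algebra_simps)
      also have "\<dots> \<le> 2 * q * b * k + b * k"
        using False by simp
      also have "\<dots> \<le> 2 * ((q + 1) * (b * k))"
        by (simp add: algebra_simps)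
      finally show ?thesis
        by (simp add: k_def)
    qed
  qed
qed

text \<open>Making \<open>weight Opt / b\<close> integral with \<open>\<delta> = 1 / q\<close> gives
  the ratio \<open>2 * a / (a + b)\<close> times \<open>q / (q + 1)\<close>, stated without
  denominators.\<close>

theorem large_matching:
  assumes b: "b = q * q" "0 < q"
  shows "\<exists>N. matching (M \<union> H) N \<and>
    2 * real a * real q * real (matching_number E) \<le> (real a + real b) * (real q + 1) * real (card N)"
proof -
  obtain Opt where Opt: "matching E Opt" "card Opt = matching_number E"
    using maximum_matching_exists[OF finE] .
  have pos: "0 < real q" "0 < real b"
    using b by auto
  have "\<exists>N. matching (M \<union> H) N \<and>
      (\<Sum>e\<in>M \<union> H. real (weight Opt e) / real b) \<le> (1 + 1 / real q) * real (card N)"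
  proof (rule integral_matching)
    show "finite (M \<union> H)" "\<And>e. e \<in> M \<union> H \<Longrightarrow> card e = 2"
      using finM finH card2 ME HE by auto
    show "(\<Sum>e | e \<in> M \<union> H \<and> v \<in> e. real (weight Opt e) / real b) \<le> 1" for v
    proof -
      have "real (\<Sum>e | e \<in> M \<union> H \<and> v \<in> e. weight Opt e) \<le> real b"
        using load_le[OF Opt(1)] of_nat_le_iff by blast
      thus ?thesis
        using pos by (simp flip: sum_divide_distrib)
    qed
    show "(\<Sum>e | e \<in> M \<union> H \<and> e \<subseteq> C. real (weight Opt e) / real b)
        \<le> (1 + 1 / real q) * real (card C div 2)" if "finite C" for C
    proof -
      have "real (q * (\<Sum>e | e \<in> M \<union> H \<and> e \<subseteq> C. weight Opt e))
          \<le> real ((q + 1) * (b * (card C div 2)))"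
        using odd_set_weight[OF Opt(1) that b] of_nat_le_iff by blast
      hence "real q * real (\<Sum>e | e \<in> M \<union> H \<and> e \<subseteq> C. weight Opt e)
          \<le> (real q + 1) * (real b * real (card C div 2))"
        by (simp only: of_nat_mult of_nat_add of_nat_1)
      thus ?thesis
        using pos by (simp add: field_simps flip: sum_divide_distrib)
    qed
  qed auto
  then obtain N where N: "matching (M \<union> H) N"
    "(\<Sum>e\<in>M \<union> H. real (weight Opt e) / real b) \<le> (1 + 1 / real q) * real (card N)"
    by blast
  define T where "T = (\<Sum>e\<in>M \<union> H. real (weight Opt e))"
  have T: "T * real q \<le> (real q + 1) * real b * real (card N)"
    using N(2) pos unfolding sum_divide_distrib[symmetric] T_def[symmetric] by (simp add: field_simps)
  have "real (2 * a * b * card Opt) \<le> real ((\<Sum>e\<in>M \<union> H. weight Opt e) * (a + b))"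
    using total_weight_ge[OF Opt(1)] of_nat_le_iff by blast
  hence "2 * real a * real b * real (card Opt) \<le> T * (real a + real b)"
    by (simp add: T_def)
  hence "2 * real a * real b * real (card Opt) * real q \<le> T * (real a + real b) * real q"
    using pos by (intro mult_right_mono) auto
  also have "\<dots> = (T * real q) * (real a + real b)"
    by simp
  also have "\<dots> \<le> ((real q + 1) * real b * real (card N)) * (real a + real b)"
    using T by (intro mult_right_mono) auto
  finally have "real b * (2 * real a * real q * real (card Opt))
      \<le> real b * ((real a + real b) * (real q + 1) * real (card N))"
    by (simp add: algebra_simps)
  hence "2 * real a * real q * real (card Opt) \<le> (real a + real b) * (real q + 1) * real (card N)"
    using pos by (simp only: mult_le_cancel_left_pos)
  thus ?thesis
    using N(1) Opt(2) by auto
qed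

end

section \<open>The algorithm\<close>

text \<open>
  An edge of the first pass is stored as an increasing pair of words, an edge of the second pass
  as a decreasing one.
\<close>

fun first_edges :: "memory \<Rightarrow> edge set" where
  "first_edges (x # y # m) = (if x < y then insert {x, y} (first_edges m) else first_edges m)"
| "first_edges _ = {}"

fun second_edges :: "memory \<Rightarrow> edge set" where
  "second_edges (x # y # m) = (if y < x then insert {x, y} (second_edges m) else second_edges m)"
| "second_edges _ = {}"

definition first_step :: "edge \<Rightarrow> memory \<Rightarrow> memory" where
  "first_step e m = (if e \<inter> \<Union>(first_edges m) = {} then Min e # Max e # m else m)"

definition second_step :: "nat \<Rightarrow> nat \<Rightarrow> edge \<Rightarrow> memory \<Rightarrow> memory" where
  "second_step a b e m =
     (if crossing (first_edges m) e \<and> e \<notin> second_edges m \<and>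
         (\<forall>v\<in>e. degree (second_edges m) v < capacity (first_edges m) a b v)
      then Max e # Min e # m else m)"

text \<open>Any maximum matching of the stored edges will do; \<open>SOME\<close> makes the output a
  function of the memory.\<close>

definition two_pass :: "nat \<Rightarrow> nat \<Rightarrow> streaming_algorithm" where
  "two_pass a b =
     \<lparr>init_mem = \<lambda>n. [],
      process_edge = \<lambda>n p. if p = 0 then first_step else second_step a b,
      finish_pass = \<lambda>n p m. m,
      output_edges = \<lambda>n m. SOME N. maximum_matching (first_edges m \<union> second_edges m) N\<rparr>"

section \<open>Stored edges and invariants of the passes\<close>

lemma Min_Max_edge:
  assumes "card (e :: edge) = 2"
  shows "{Min e, Max e} = e" "{Max e, Min e} = e" "Min e < Max e"
proof -
  obtain x y where "e = {x, y}" "x < y"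
    using assms by (metis card_2_iff doubleton_eq_iff linorder_neqE_nat)
  thus "{Min e, Max e} = e" "{Max e, Min e} = e" "Min e < Max e"
    by auto
qed

lemma stored_edges_Cons:
  assumes "card e = 2"
  shows "first_edges (Min e # Max e # m) = insert e (first_edges m)"
    "second_edges (Min e # Max e # m) = second_edges m"
    "first_edges (Max e # Min e # m) = first_edges m"
    "second_edges (Max e # Min e # m) = insert e (second_edges m)"
  using Min_Max_edge[OF assms] by auto

lemma words_of_edge:
  assumes "graph_on n E" "e \<in> E"
  shows "Min e \<le> n" "Max e \<le> n"
proof -
  have e: "card e = 2" "e \<subseteq> {..<n}"
    using assms by (auto simp: graph_on_def)
  hence "Min e \<in> e" "Max e \<in> e"
    using Min_Max_edge(1)[OF e(1)] by blast+
  thus "Min e \<le> n" "Max e \<le> n"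
    using e(2) by (auto intro: less_imp_le)
qed

lemma degree_insert:
  assumes "finite H" "e \<notin> H"
  shows "degree (insert e H) v = (if v \<in> e then Suc (degree H v) else degree H v)"
proof -
  have "{f \<in> insert e H. v \<in> f} = (if v \<in> e then insert e {f\<in>H. v \<in> f} else {f\<in>H. v \<in> f})"
    by auto
  thus ?thesis
    using assms by (simp add: degree_def)
qed

text \<open>The greedy invariant: an edge is stored or meets a stored one, and stored edges are
  never removed. It covers any list of edges of \<open>E\<close>, as the space bound needs it for
  prefixes of the stream.\<close>

lemma first_pass:
  assumes G: "graph_on n E" and "set xs \<subseteq> E" and m: "m = fold first_step xs []"
  shows "matching (set xs) (first_edges m)" "second_edges m = {}"
    "\<forall>e\<in>set xs. e \<inter> \<Union>(first_edges m) \<noteq> {}"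
    "length m = 2 * card (first_edges m)" "set m \<subseteq> {0..n}"
proof -
  have "matching (set xs) (first_edges m) \<and> second_edges m = {} \<and>
    (\<forall>e\<in>set xs. e \<inter> \<Union>(first_edges m) \<noteq> {}) \<and>
    length m = 2 * card (first_edges m) \<and> set m \<subseteq> {0..n}"
    using assms(2) unfolding m
  proof (induction xs rule: rev_induct)
    case (snoc e xs)
    define m where "m = fold first_step xs []"
    have IH: "matching (set xs) (first_edges m)" "second_edges m = {}"
      "\<forall>e\<in>set xs. e \<inter> \<Union>(first_edges m) \<noteq> {}"
      "length m = 2 * card (first_edges m)" "set m \<subseteq> {0..n}"
      using snoc by (auto simp: m_def)
    have e: "e \<in> E" "card e = 2"
      using snoc.prems G by (auto simp: graph_on_def)
    hence "e \<noteq> {}"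
      by auto
    have fin: "finite (first_edges m)"
      using IH(1) by (rule matching_finite[rotated]) simp
    have M: "matching (insert e (set xs)) (first_edges m)"
      using IH(1) by (rule matching_mono) blast
    show ?case
    proof (cases "e \<inter> \<Union>(first_edges m) = {}")
      case True
      hence new: "e \<notin> first_edges m"
        using \<open>e \<noteq> {}\<close> by blast
      have "fold first_step (xs @ [e]) [] = Min e # Max e # m"
        using True by (simp add: m_def first_step_def)
      moreover have "matching (insert e (set xs)) (insert e (first_edges m))"
        by (rule matching_insert[OF M _ True]) simp
      moreover have "\<forall>f\<in>insert e (set xs). f \<inter> \<Union>(insert e (first_edges m)) \<noteq> {}"
        using IH(3) \<open>e \<noteq> {}\<close> by blast
      ultimately show ?thesis
        using IH(2,4,5) new fin words_of_edge[OF G e(1)]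
        by (simp add: stored_edges_Cons[OF e(2)] del: first_edges.simps second_edges.simps Union_insert)
    next
      case False
      hence "fold first_step (xs @ [e]) [] = m"
        by (simp add: m_def first_step_def)
      thus ?thesis
        using M IH(2-5) False by simp
    qed
  qed simp
  thus "matching (set xs) (first_edges m)" "second_edges m = {}"
    "\<forall>e\<in>set xs. e \<inter> \<Union>(first_edges m) \<noteq> {}"
    "length m = 2 * card (first_edges m)" "set m \<subseteq> {0..n}"
    by blast+
qed

text \<open>Decreasing pairs leave \<open>first_edges\<close> unchanged, so \<open>M\<close> and the
  capacities stay fixed. Degrees only grow, so the saturated end that caused a rejection remains
  saturated.\<close>

lemma second_pass:
  assumes G: "graph_on n E" and "set xs \<subseteq> E" and m\<^sub>0: "second_edges m\<^sub>0 = {}" "set m\<^sub>0 \<subseteq> {0..n}"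
    and m: "m = fold (second_step a b) xs m\<^sub>0" and H: "H = second_edges m"
    and M: "M = first_edges m\<^sub>0"
  shows "first_edges m = M" "H \<subseteq> set xs"
    "\<forall>e\<in>H. crossing M e" "\<forall>v. degree H v \<le> capacity M a b v"
    "\<forall>e\<in>set xs. crossing M e \<longrightarrow> e \<in> H \<or> (\<exists>v\<in>e. capacity M a b v \<le> degree H v)"
    "length m = length m\<^sub>0 + 2 * card H" "set m \<subseteq> {0..n}"
proof -
  define good where "good xs m H \<longleftrightarrow> first_edges m = M \<and> H \<subseteq> set xs \<and>
    (\<forall>e\<in>H. crossing M e) \<and> (\<forall>v. degree H v \<le> capacity M a b v) \<and>
    (\<forall>e\<in>set xs. crossing M e \<longrightarrow> e \<in> H \<or> (\<exists>v\<in>e. capacity M a b v \<le> degree H v)) \<and>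
    length m = length m\<^sub>0 + 2 * card H \<and> set m \<subseteq> {0..n}" for xs m H
  have "good xs m H"
    using assms(2) unfolding H m
  proof (induction xs rule: rev_induct)
    case Nil
    show ?case
      using m\<^sub>0 by (simp add: good_def M degree_def)
  next
    case (snoc e xs)
    define m where "m = fold (second_step a b) xs m\<^sub>0"
    define H where "H = second_edges m"
    have "good xs m H"
      using snoc by (simp add: m_def H_def)
    hence IH: "first_edges m = M" "H \<subseteq> set xs"
      "\<forall>e\<in>H. crossing M e" "\<And>v. degree H v \<le> capacity M a b v"
      "\<And>e. e \<in> set xs \<Longrightarrow> crossing M e \<Longrightarrow> e \<in> H \<or> (\<exists>v\<in>e. capacity M a b v \<le> degree H v)"
      "length m = length m\<^sub>0 + 2 * card H" "set m \<subseteq> {0..n}"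
      unfolding good_def by blast+
    have e: "e \<in> E" "card e = 2"
      using snoc.prems G by (auto simp: graph_on_def)
    have fin: "finite H"
      using IH(2) by (rule finite_subset) simp
    show ?case
    proof (cases "crossing M e \<and> e \<notin> H \<and> (\<forall>v\<in>e. degree H v < capacity M a b v)")
      case True
      have fold: "fold (second_step a b) (xs @ [e]) m\<^sub>0 = Max e # Min e # m"
        using True IH(1) by (simp add: m_def[symmetric] H_def second_step_def)
      have deg: "degree (insert e H) v = (if v \<in> e then Suc (degree H v) else degree H v)" for v
        using True fin by (simp add: degree_insert)
      have "degree H v \<le> degree (insert e H) v" "degree (insert e H) v \<le> capacity M a b v" for v
        using True IH(4)[of v] by (auto simp: deg Suc_le_eq)
      moreover from this have "f \<in> insert e H \<or> (\<exists>v\<in>f. capacity M a b v \<le> degree (insert e H) v)"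
        if "f \<in> set (xs @ [e])" "crossing M f" for f
        using IH(5)[of f] that by (auto intro: order_trans)
      moreover have "H \<subseteq> set (xs @ [e])"
        using IH(2) by auto
      ultimately have "good (xs @ [e]) (Max e # Min e # m) (insert e H)"
        using True IH(1,3,6,7) fin words_of_edge[OF G e(1)]
        by (simp add: good_def stored_edges_Cons[OF e(2)] del: first_edges.simps second_edges.simps)
      thus ?thesis
        unfolding fold stored_edges_Cons(4)[OF e(2)] H_def .
    next
      case False
      have fold: "fold (second_step a b) (xs @ [e]) m\<^sub>0 = m"
        using False IH(1) by (auto simp: m_def[symmetric] H_def second_step_def)
      have "good (xs @ [e]) m H"
        unfolding good_def using IH False by (auto simp: not_less)
      thus ?thesis
        unfolding fold H_def .
    qed
  qed
  thus "first_edges m = M" "H \<subseteq> set xs"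
    "\<forall>e\<in>H. crossing M e" "\<forall>v. degree H v \<le> capacity M a b v"
    "\<forall>e\<in>set xs. crossing M e \<longrightarrow> e \<in> H \<or> (\<exists>v\<in>e. capacity M a b v \<le> degree H v)"
    "length m = length m\<^sub>0 + 2 * card H" "set m \<subseteq> {0..n}"
    unfolding good_def by blast+
qed

section \<open>Space bound\<close>

text \<open>Each edge of \<open>H\<close> has an end in \<open>\<Union>M\<close>, and at most
  \<open>a\<close> edges were kept there. This makes \<open>H\<close> linear in the number of
  vertices.\<close>

lemma card_crossing_le:
  assumes "finite (\<Union>M)" "\<forall>e\<in>H. crossing M e" "\<forall>v. degree H v \<le> capacity M a b v"
    and "finite H"
  shows "card H \<le> a * card (\<Union>M)"
proof -
  have "H \<subseteq> (\<Union>v\<in>\<Union>M. {e\<in>H. v \<in> e})"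
    using assms(2) by (fastforce simp: crossing_def card_1_singleton_iff)
  hence "card H \<le> card (\<Union>v\<in>\<Union>M. {e\<in>H. v \<in> e})"
    using assms(1,4) by (intro card_mono finite_UN_I) auto
  also have "\<dots> \<le> (\<Sum>v\<in>\<Union>M. card {e\<in>H. v \<in> e})"
    by (rule card_UN_le[OF assms(1)])
  also have "\<dots> \<le> (\<Sum>v\<in>\<Union>M. a)"
  proof (rule sum_mono)
    fix v assume "v \<in> \<Union>M"
    thus "card {e\<in>H. v \<in> e} \<le> a"
      using assms(3) by (metis capacity_def degree_def)
  qed
  finally show ?thesis
    by (simp add: mult.commute)
qed

text \<open>An edge takes two words. The matching takes at most \<open>n\<close> words because its
  edges are disjoint, and \<open>H\<close> takes at most \<open>2 * a * n\<close>. Every memory that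
  occurs is a fold over a prefix of the stream.\<close>

lemma two_pass_space: "runs_in_space (two_pass a b) 2 (\<lambda>n. (1 + 2 * a) * n)"
  unfolding runs_in_space_def
proof (intro allI impI ballI)
  fix n E xs m
  assume G: "graph_on n E" and xs: "edge_stream E xs" and m: "m \<in> memories (two_pass a b) 2 n xs"
  define m1 where "m1 = fold first_step xs []"
  have E: "set xs \<subseteq> E"
    using xs by (simp add: edge_stream_def)
  have M_bound: "card (\<Union>(first_edges (fold first_step ys []))) \<le> n"
    "2 * card (first_edges (fold first_step ys [])) \<le> n" if "set ys \<subseteq> E" for ys
  proof -
    let ?M = "first_edges (fold first_step ys [])"
    have mat: "matching E ?M"
      using matching_mono[OF first_pass(1)[OF G that refl] that] .
    have "\<Union>?M \<subseteq> {..<n}"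
      using mat G by (auto simp: matching_def graph_on_def)
    hence "card (\<Union>?M) \<le> card {..<n}"
      by (intro card_mono) auto
    thus "card (\<Union>?M) \<le> n" by simp
    thus "2 * card ?M \<le> n"
      using matching_card_Union[OF mat] G by (auto simp: graph_on_def)
  qed
  have first: "fits_space n ((1 + 2 * a) * n) (fold first_step ys [])" if "set ys \<subseteq> E" for ys
    using M_bound(2)[OF that] first_pass(4,5)[OF G that refl] by (simp add: fits_space_def)
  have second: "fits_space n ((1 + 2 * a) * n) (fold (second_step a b) ys m1)" if ys: "set ys \<subseteq> E" for ys
  proof -
    let ?H = "second_edges (fold (second_step a b) ys m1)"
    note m1 = first_pass[OF G E m1_def]
    note m2 = second_pass[OF G ys m1(2,5) refl refl refl, of a b]
    have "finite (\<Union>(first_edges m1))"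
      using m1(1) G E by (auto simp: matching_def graph_on_def intro!: finite_subset[of "\<Union>(first_edges m1)" "{..<n}"])
    hence "card ?H \<le> a * card (\<Union>(first_edges m1))"
      using m2(2) by (intro card_crossing_le[OF _ m2(3,4)]) (auto intro: finite_subset)
    also have "\<dots> \<le> a * n"
      using M_bound(1)[OF E] by (simp add: m1_def)
    finally show ?thesis
      using m2(6,7) m1(4) M_bound(2)[OF E] by (simp add: fits_space_def m1_def)
  qed
  have after: "mem_after_passes (two_pass a b) n xs 0 = fold first_step [] []"
    "mem_after_passes (two_pass a b) n xs 1 = m1"
    "mem_after_passes (two_pass a b) n xs 2 = fold (second_step a b) xs m1"
    by (simp_all add: two_pass_def m1_def numeral_2_eq_2)
  have take: "set (take i xs) \<subseteq> E" for i
    using E set_take_subset by fastforce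
  have "mem_during_pass (two_pass a b) n xs 0 i = fold first_step (take i xs) []"
    "mem_during_pass (two_pass a b) n xs 1 i = fold (second_step a b) (take i xs) m1" for i
    unfolding mem_during_pass_def after by (simp_all add: two_pass_def)
  moreover have "p < 2 \<longleftrightarrow> p = 0 \<or> p = 1" "p \<le> 2 \<longleftrightarrow> p = 0 \<or> p = 1 \<or> p = 2" for p :: nat
    by auto
  ultimately consider i where "m = fold first_step (take i xs) []"
    | i where "m = fold (second_step a b) (take i xs) m1"
    | "m = fold first_step [] []" | "m = m1" | "m = fold (second_step a b) xs m1"
    using m after unfolding memories_def by auto
  thus "fits_space n ((1 + 2 * a) * n) m"
    using first[OF take] second[OF take] first[of "[]"] first[OF E] second[OF E]
    by cases (simp_all add: m1_def)
qed

section \<open>Approximation ratio and choice of the parameters\<close>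

lemma two_pass_approximates:
  assumes ab: "0 < a" "a \<le> b" "a * a + 2 * a * b \<le> b * b" and q: "b = q * q" "0 < q"
    and \<alpha>: "\<alpha> * ((real a + real b) * (real q + 1)) \<le> 2 * real a * real q"
  shows "approximates_matching (two_pass a b) 2 \<alpha>"
  unfolding approximates_matching_def
proof (intro allI impI)
  fix n E xs
  assume G: "graph_on n E" and xs: "edge_stream E xs"
  define m1 where "m1 = fold first_step xs []"
  define m2 where "m2 = fold (second_step a b) xs m1"
  define M H where "M = first_edges m1" and "H = second_edges m2"
  have E: "set xs = E"
    using xs by (simp add: edge_stream_def)
  note first = first_pass[OF G equalityD1[OF E] m1_def, folded M_def, unfolded E]
  note second = second_pass[OF G equalityD1[OF E] first(2,5) m2_def H_def M_def, unfolded E]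
  interpret extended_matching E M H a b
    by unfold_locales (use graph_on_finite[OF G] G first second ab in \<open>auto simp: graph_on_def\<close>)
  obtain N where N: "matching (M \<union> H) N"
    "2 * real a * real q * real (matching_number E) \<le> (real a + real b) * (real q + 1) * real (card N)"
    using large_matching[OF q] by blast
  define R where "R = result (two_pass a b) 2 n xs"
  have "R = (SOME N. maximum_matching (M \<union> H) N)"
    using second(1) by (simp add: R_def result_def two_pass_def numeral_2_eq_2 m1_def m2_def H_def M_def)
  moreover have "\<exists>N. maximum_matching (M \<union> H) N"
    using maximum_matching_exists[of "M \<union> H"] finM finH by (auto simp: maximum_matching_def)
  ultimately have "maximum_matching (M \<union> H) R"
    by (simp add: someI_ex)
  hence R: "matching (M \<union> H) R" "card R = matching_number (M \<union> H)"
    by (auto simp: maximum_matching_def)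
  have "matching E R"
    using R(1) ME HE by (auto intro: matching_mono)
  let ?c = "(real a + real b) * (real q + 1)"
  have "?c * (\<alpha> * real (matching_number E)) = (\<alpha> * ?c) * real (matching_number E)"
    by simp
  also have "\<dots> \<le> 2 * real a * real q * real (matching_number E)"
    using \<alpha> by (rule mult_right_mono) simp
  also have "\<dots> \<le> ?c * real (card N)"
    by (rule N(2))
  also have "\<dots> \<le> ?c * real (card R)"
    using card_le_matching_number[OF _ N(1)] finM finH R(2) by (intro mult_left_mono) auto
  finally have "\<alpha> * real (matching_number E) \<le> real (card R)"
    using ab(1) by (subst (asm) mult_le_cancel_left_pos) auto
  thus "matching E (result (two_pass a b) 2 n xs) \<and>
      \<alpha> * real (matching_number E) \<le> real (card (result (two_pass a b) 2 n xs))"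
    using \<open>matching E R\<close> by (simp add: R_def)
qed

text \<open>
  The ratio \<open>r = a / b\<close> tends to \<open>sqrt 2 - 1\<close>, the positive root of \<open>r\<^sup>2 + 2 r = 1\<close>, and
  \<open>2 r / (1 + r) = 2 - sqrt 2\<close> there.
\<close>

lemma parameters_exist:
  assumes "\<epsilon> > 0"
  shows "\<exists>a b q :: nat. 0 < a \<and> a \<le> b \<and> a * a + 2 * a * b \<le> b * b \<and> b = q * q \<and> 0 < q \<and>
    (2 - sqrt 2 - \<epsilon>) * ((real a + real b) * (real q + 1)) \<le> 2 * real a * real q"
proof -
  obtain q\<^sub>0 :: nat where "3 / \<epsilon> < real q\<^sub>0"
    using reals_Archimedean2 by blast
  \<comment> \<open>The bound by \<open>q\<^sub>0\<close> lets \<open>\<epsilon> * q\<close> absorb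
    three error terms of size \<open>a + b\<close>; \<open>q \<ge> 2\<close> gives
    \<open>b \<ge> 4\<close>, so that \<open>a\<close> is positive.\<close>
  define q where "q = max 2 q\<^sub>0"
  define b where "b = q * q"
  define s where "s = sqrt 2"
  \<comment> \<open>Rounding down keeps \<open>a / b\<close> at or below \<open>sqrt 2 - 1\<close>,
    as the condition on \<open>a\<close> and \<open>b\<close> demands.\<close>
  define a where "a = nat \<lfloor>(s - 1) * real b\<rfloor>"
  have "s * s = 2"
    by (simp add: s_def)
  moreover have "1.4 < s"
    unfolding s_def by (rule real_less_rsqrt) (simp add: power2_eq_square)
  moreover have "s < 1.5"
    unfolding s_def by (rule real_less_lsqrt) (simp_all add: power2_eq_square)
  ultimately have s: "s * s = 2" "1.4 < s" "s < 1.5"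
    by blast+
  have q: "2 \<le> real q" "3 \<le> \<epsilon> * real q"
  proof -
    have "3 / \<epsilon> \<le> real q"
      using \<open>3 / \<epsilon> < real q\<^sub>0\<close> by (simp add: q_def)
    thus "3 \<le> \<epsilon> * real q"
      using assms by (simp add: field_simps)
  qed (simp add: q_def)
  have b: "real b = real q * real q" "4 \<le> real b"
    using mult_mono[OF q(1) q(1)] by (simp_all add: b_def)
  have a_le: "real a \<le> (s - 1) * real b" and a_ge: "(s - 1) * real b - 1 \<le> real a"
    using s b by (simp_all add: a_def)
  have "0 < a"
  proof -
    have "0.4 * 4 \<le> (s - 1) * real b"
      using s b by (intro mult_mono) auto
    hence "0 < real a"
      using a_ge by linarith
    thus ?thesis by simp
  qed
  moreover have "a \<le> b"
  proof -
    have "(s - 1) * real b \<le> 1 * real b"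
      using s by (intro mult_right_mono) auto
    thus ?thesis
      using a_le by simp
  qed
  moreover have "a * a + 2 * a * b \<le> b * b"
  proof -
    have "(real a + real b) * (real a + real b) \<le> (s * real b) * (s * real b)"
      using a_le s by (intro mult_mono) (auto simp: algebra_simps)
    also have "\<dots> = (s * s) * (real b * real b)"
      by (simp only: ac_simps)
    also have "\<dots> = 2 * (real b * real b)"
      by (simp only: s(1))
    finally have "real (a * a + 2 * a * b) \<le> real (b * b)"
      by (simp add: algebra_simps)
    thus ?thesis
      by (simp only: of_nat_le_iff)
  qed
  moreover have "(2 - s - \<epsilon>) * ((real a + real b) * (real q + 1)) \<le> 2 * real a * real q"
  proof -
    \<comment> \<open>Without rounding this would be an equality lacking the final \<open>s\<close>;
      rounding \<open>a\<close> down by at most \<open>1\<close> costs at most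
      \<open>s\<close>.\<close>
    have loss: "(2 - s) * (real a + real b) \<le> 2 * real a + s"
    proof -
      have "s * ((s - 1) * real b - 1) \<le> s * real a"
        using a_ge s by (intro mult_left_mono) auto
      moreover have "s * ((s - 1) * real b - 1) = (s * s - s) * real b - s"
        by (simp add: algebra_simps)
      ultimately have "(2 - s) * real b - s \<le> s * real a"
        by (simp only: s(1))
      thus ?thesis
        by (simp add: algebra_simps)
    qed
    have ab: "real b \<le> real a + real b" "0 \<le> real a + real b"
      by auto
    have "(2 - s) * ((real a + real b) * (real q + 1)) =
        ((2 - s) * (real a + real b)) * real q + (2 - s) * (real a + real b)"
      by (simp add: algebra_simps)
    also have "\<dots> \<le> (2 * real a + s) * real q + 1 * (real a + real b)"
      using loss s ab by (intro add_mono mult_right_mono) auto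
    also have "\<dots> = 2 * real a * real q + (s * real q + (real a + real b))"
      by (simp add: algebra_simps)
    \<comment> \<open>The rounding loss \<open>s * q\<close> is at most \<open>2 * b\<close>, and
      the factor \<open>q + 1\<close> in place of \<open>q\<close> costs one more
      \<open>a + b\<close>; hence the \<open>3\<close> in the choice of \<open>q\<close>.\<close>
    also have "s * real q + (real a + real b) \<le> 3 * (real a + real b)"
    proof -
      have "s * real q \<le> 2 * real b"
        using s q mult_mono[of s 2 "real q" "real b"] by (simp add: b mult_le_cancel_right1)
      moreover have "0 \<le> real a"
        by simp
      ultimately show ?thesis
        by argo
    qed
    also have "3 * (real a + real b) \<le> (\<epsilon> * real q) * (real a + real b)"
      using q(2) ab by (intro mult_right_mono) auto
    also have "\<dots> \<le> \<epsilon> * ((real a + real b) * (real q + 1))"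
      using assms ab by (simp add: algebra_simps)
    finally show ?thesis
      by (simp add: algebra_simps)
  qed
  moreover have "0 < q"
    by (simp add: q_def)
  ultimately show ?thesis
    unfolding s_def b_def by blast
qed

theorem theorem2:
  fixes \<epsilon> :: real
  assumes "\<epsilon> > 0"
  shows "\<exists>(A :: streaming_algorithm) (s :: nat \<Rightarrow> nat).
           approximates_matching A 2 (2 - sqrt 2 - \<epsilon>) \<and>
           runs_in_space A 2 s \<and>
           (\<lambda>n. real (s n)) \<in> O(\<lambda>n. real n)"
proof -
  obtain a b q :: nat where "0 < a" "a \<le> b" "a * a + 2 * a * b \<le> b * b" "b = q * q" "0 < q"
    "(2 - sqrt 2 - \<epsilon>) * ((real a + real b) * (real q + 1)) \<le> 2 * real a * real q"
    using parameters_exist[OF assms] by blast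
  hence "approximates_matching (two_pass a b) 2 (2 - sqrt 2 - \<epsilon>)"
    by (rule two_pass_approximates)
  \<comment> \<open>\<open>a\<close> was chosen from \<open>\<epsilon>\<close> alone, so
    \<open>1 + 2 * a\<close> is a constant.\<close>
  moreover have "(\<lambda>n. real ((1 + 2 * a) * n)) \<in> O(\<lambda>n. real n)"
    by (rule bigoI[of _ "1 + 2 * real a"]) (simp add: algebra_simps)
  ultimately show ?thesis
    using two_pass_space by blast
qed

end
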